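(* Let $A\in\mathbb{R}^{n\times n}$ be invertible and symmetric, let $X_k\in\mathbb{R}^{n\times n}$ be symmetric, let $W\in\mathbb{R}^{n\times n}$ be symmetric positive definite and let $S\in\mathbb{R}^{n\times q}$. Then the following two problems define the same matrix $X_{k+1}$: $$X_{k+1}=\arg\min_{X\in\mathbb{R}^{n\times n}}\tfrac12\|X-X_k\|_{F(W^{-1})}^2\quad\text{subject to}\quad S^TAX=S^T,\quad X=X^T,$$ $$X_{k+1}=\arg_X\min_{X\in\mathbb{R}^{n\times n},\,Y\in\mathbb{R}^{n\times q}}\tfrac12\|X-A^{-1}\|_{F(W^{-1})}^2\quad\text{subject to}\quad X=X_k+\tfrac12\left(YS^TAW+WA^TSY^T\right).$$ Furthermore, if $S$ has full column rank and $\Lambda=(S^TAWAS)^{-1}$, then the explicit solution to both problems is $$X_{k+1}=X_k-(X_kA-I)S\Lambda S^TAW+WAS\Lambda S^T(AX_k-I)(AS\Lambda S^TAW-I).$$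
   Context: $I$ is the $n\times n$ identity matrix. For symmetric positive definite $W$, the weighted Frobenius norm is $\|X\|_{F(W^{-1})}^2=\mathrm{Tr}(X^TW^{-1}XW^{-1})=\|W^{-1/2}XW^{-1/2}\|_F^2$, where $\|\cdot\|_F$ is the standard Frobenius norm. The notation $\arg_X\min_{X,Y}$ means that the minimization is over the pair $(X,Y)$ and the $X$-component of a minimizer is returned. *)

theory Defs
  imports "HOL-Analysis.Analysis"
begin

definition symmetric_matrix :: "real^'n^'n \<Rightarrow> bool" where
  "symmetric_matrix A \<longleftrightarrow> transpose A = A"

definition sym_pos_def :: "real^'n^'n \<Rightarrow> bool" where
  "sym_pos_def W \<longleftrightarrow> symmetric_matrix W \<and> (\<forall>x. x \<noteq> 0 \<longrightarrow> 0 < x \<bullet> (W *v x))"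

text \<open>
  The weighted Frobenius norm with weight \<open>M\<close>, where \<open>M\<close> is symmetric positive definite, so that
  the radicand is nonnegative (see \<open>weighted_frobenius_norm_sqrt\<close> below). The norm written
  with subscript \<open>F(W\<^sup>-\<^sup>1)\<close> is obtained for \<open>M = matrix_inv W\<close>.
\<close>

definition weighted_frobenius_norm :: "real^'n^'n \<Rightarrow> real^'n^'n \<Rightarrow> real" where
  "weighted_frobenius_norm M X = sqrt (trace (transpose X ** M ** X ** M))"

lemma norm_matrix_eq_trace:
  fixes X :: "real^'n^'m"
  shows "norm X = sqrt (trace (transpose X ** X))"
proof -
  have "trace (transpose X ** X) = (\<Sum>i\<in>UNIV. \<Sum>j\<in>UNIV. (X $ j $ i)\<^sup>2)"
    by (simp add: trace_def matrix_matrix_mult_def transpose_def power2_eq_square)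
  also have "\<dots> = (\<Sum>j\<in>UNIV. \<Sum>i\<in>UNIV. (X $ j $ i)\<^sup>2)"
    by (rule sum.swap)
  also have "\<dots> = X \<bullet> X"
    by (simp add: inner_vec_def power2_eq_square)
  finally show ?thesis
    by (simp add: norm_eq_sqrt_inner)
qed

text \<open>The library norm on matrices is the Frobenius norm, and \<open>R\<close> plays the role of the symmetric
  square root of \<open>M\<close>.\<close>

lemma weighted_frobenius_norm_sqrt:
  fixes M R X :: "real^'n^'n"
  assumes "symmetric_matrix R" and "R ** R = M"
  shows "weighted_frobenius_norm M X = norm (R ** X ** R)"
proof -
  have "trace (transpose X ** M ** X ** M) = trace ((transpose X ** R ** R ** X ** R) ** R)"
    using assms(2) by (simp add: matrix_mul_assoc [symmetric])
  also have "\<dots> = trace (R ** (transpose X ** R ** R ** X ** R))"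
    by (rule trace_mul_sym)
  also have "\<dots> = trace (transpose (R ** X ** R) ** (R ** X ** R))"
    using assms(1) by (simp add: symmetric_matrix_def matrix_transpose_mul matrix_mul_assoc)
  finally show ?thesis
    by (simp add: weighted_frobenius_norm_def norm_matrix_eq_trace)
qed

end

theory Submission
  imports Defs
begin

text \<open>
  Put \<open>B = A S\<close>, \<open>E = X\<^sub>k - A\<^sup>-\<^sup>1\<close> and \<open>\<langle>U, V\<rangle> = Tr (U\<^sup>T W\<^sup>-\<^sup>1 V W\<^sup>-\<^sup>1)\<close>.
  The feasible sets of the two problems are \<open>A\<^sup>-\<^sup>1 + L\<close> with \<open>L = {D. D = D\<^sup>T \<and> B\<^sup>T D = 0}\<close> and
  \<open>X\<^sub>k + K\<close> with \<open>K = {Y B\<^sup>T W + W B Y\<^sup>T}\<close>. The subspaces \<open>L\<close> and \<open>K\<close> are orthogonal, so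
  by Pythagoras a common point of the two affine sets is the unique solution of both problems.
  Such a point is \<open>A\<^sup>-\<^sup>1 + (I - W P) E (I - P W)\<close>, where \<open>P = B H\<close> and \<open>H\<close> solves the normal
  equation \<open>B\<^sup>T W B H = B\<^sup>T\<close>. This equation is solvable even if \<open>S\<close> does not have full column rank;
  if it does, \<open>H = \<Lambda> B\<^sup>T\<close>.
\<close>

section \<open>Semidefinite quadratic forms\<close>

text \<open>Semidefiniteness is isolated because \<open>transpose X ** M ** X\<close> is in general
  only semidefinite, even for positive definite \<open>M\<close>.\<close>

definition pos_semidef :: "real^'n^'n \<Rightarrow> bool" where
  "pos_semidef M \<longleftrightarrow> symmetric_matrix M \<and> (\<forall>x. 0 \<le> x \<bullet> (M *v x))"

lemma inner_symmetric_matrix: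
  assumes "symmetric_matrix M"
  shows "x \<bullet> (M *v y) = y \<bullet> (M *v x)"
  using assms dot_lmul_matrix[of x M y]
  by (simp add: symmetric_matrix_def inner_commute flip: transpose_matrix_vector)

lemma quadratic_nonneg_imp_discriminant:
  fixes a b c :: real
  assumes "0 \<le> c" and "\<And>t. 0 \<le> a + 2 * b * t + c * t\<^sup>2"
  shows "b\<^sup>2 \<le> a * c"
proof (cases "c = 0")
  case True
  have "b = 0"
  proof (rule ccontr)
    assume "b \<noteq> 0"
    \<comment> \<open>At this \<open>t\<close> the polynomial, affine because \<open>c = 0\<close>,
      takes the value -1.\<close>
    then show False using assms(2)[of "- (a + 1) / (2 * b)"] True by simp
  qed
  with True show ?thesis by simp
next
  case False
  \<comment> \<open>\<open>- b / c\<close> is the minimizer of the quadratic.\<close>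
  then show ?thesis using assms(1) assms(2)[of "- b / c"]
    by (simp add: power2_eq_square field_simps)
qed

text \<open>The form is nonnegative along the line \<open>x + t y\<close>, so its discriminant as a
  quadratic in \<open>t\<close> gives the bound.\<close>

lemma pos_semidef_Cauchy_Schwarz:
  assumes "pos_semidef M"
  shows "(x \<bullet> (M *v y))\<^sup>2 \<le> (x \<bullet> (M *v x)) * (y \<bullet> (M *v y))"
proof (rule quadratic_nonneg_imp_discriminant)
  show "0 \<le> y \<bullet> (M *v y)" using assms by (simp add: pos_semidef_def)
  fix t :: real
  have "0 \<le> (x + t *\<^sub>R y) \<bullet> (M *v (x + t *\<^sub>R y))"
    using assms by (simp add: pos_semidef_def)
  also have "\<dots> = x \<bullet> (M *v x) + 2 * (x \<bullet> (M *v y)) * t + (y \<bullet> (M *v y)) * t\<^sup>2"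
    using assms inner_symmetric_matrix[of M y x]
    by (simp add: pos_semidef_def matrix_vector_right_distrib inner_simps
        matrix_vector_mult_scaleR power2_eq_square algebra_simps)
  finally show "0 \<le> x \<bullet> (M *v x) + 2 * (x \<bullet> (M *v y)) * t + (y \<bullet> (M *v y)) * t\<^sup>2" .
qed

text \<open>Cauchy-Schwarz for the pair \<open>M *v x\<close> and \<open>x\<close> bounds the fourth
  power of the norm of \<open>M *v x\<close> by 0.\<close>

lemma pos_semidef_kernel:
  assumes "pos_semidef M" and "x \<bullet> (M *v x) = 0"
  shows "M *v x = 0"
  using pos_semidef_Cauchy_Schwarz[OF assms(1), of "M *v x" x] assms(2) by simp

section \<open>Rank-one matrices and traces of products\<close>

definition outer_square :: "real^'n \<Rightarrow> real^'n^'n" where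
  "outer_square v = (\<chi> i j. v $ i * v $ j)"

lemma outer_square_mult_vec: "outer_square v *v x = (v \<bullet> x) *\<^sub>R v"
  by (simp add: outer_square_def matrix_vector_mult_def vec_eq_iff inner_vec_def
      sum_distrib_left sum_distrib_right algebra_simps)

lemma matrix_mult_outer_square:
  "C ** outer_square v = (\<chi> i j. (C *v v) $ i * v $ j)"
  by (simp add: outer_square_def matrix_matrix_mult_def matrix_vector_mult_def vec_eq_iff
      sum_distrib_right mult.assoc)

lemma trace_mult_outer_square: "trace (C ** outer_square v) = v \<bullet> (C *v v)"
  by (simp add: matrix_mult_outer_square trace_def inner_vec_def mult.commute)

lemma matrix_diff_ldistrib: "A ** (B - C) = A ** B - A ** C"
  for A :: "real^'n^'m" and B C :: "real^'p^'n"
  by (simp add: matrix_matrix_mult_def vec_eq_iff sum_subtractf algebra_simps)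

lemma matrix_diff_rdistrib: "(B - C) ** A = B ** A - C ** A"
  for A :: "real^'p^'n" and B C :: "real^'n^'m"
  by (simp add: matrix_matrix_mult_def vec_eq_iff sum_subtractf algebra_simps)

lemma matrix_add_rdistrib: "(B + C) ** A = B ** A + C ** A"
  for A :: "real^'p^'n" and B C :: "real^'n^'m"
  by (simp add: matrix_matrix_mult_def vec_eq_iff sum.distrib algebra_simps)

lemma transpose_add: "transpose (A + B) = transpose A + transpose B"
  for A B :: "real^'n^'m"
  by (simp add: transpose_def vec_eq_iff)

lemma transpose_diff: "transpose (A - B) = transpose A - transpose B"
  for A B :: "real^'n^'m"
  by (simp add: transpose_def vec_eq_iff)

lemma trace_transpose: "trace (transpose A) = trace A"
  for A :: "real^'n^'n"
  by (simp add: trace_def transpose_def)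

lemma trace_scaleR: "trace (c *\<^sub>R A) = c * trace A"
  for A :: "real^'n^'n"
  by (simp add: trace_def sum_distrib_left)

text \<open>Symmetric Gaussian elimination, which avoids the square root of \<open>M\<close>: subtracting a rank-one
  matrix from \<open>M\<close> annihilates one more basis vector and keeps \<open>M\<close> positive semidefinite, by the
  Cauchy-Schwarz inequality.\<close>

lemma trace_pos_semidef_mult_aux:
  fixes C M :: "real^'n^'n"
  assumes "finite F" and "pos_semidef C" and "pos_semidef M"
    and "\<And>j. j \<notin> F \<Longrightarrow> M *v axis j 1 = 0"
  shows "0 \<le> trace (C ** M) \<and> (trace (C ** M) = 0 \<longrightarrow> C ** M = 0)"
  using assms(1,3,4)
proof (induction F arbitrary: M rule: finite_induct)
  case empty
  have "M = 0"
    using empty by (simp add: vec_eq_iff matrix_vector_mult_basis column_def)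
  then show ?case by (simp add: trace_def)
next
  case (insert i F)
  define e where "e = (axis i 1 :: real^'n)"
  define m where "m = M *v e"
  define d where "d = e \<bullet> m"
  have psd: "\<And>x. 0 \<le> x \<bullet> (M *v x)" and sym: "symmetric_matrix M"
    using insert.prems by (auto simp: pos_semidef_def)
  show ?case
  proof (cases "d = 0")
    case True
    \<comment> \<open>A zero pivot of a semidefinite matrix forces a zero column, so the induction
      hypothesis applies to \<open>M\<close> itself.\<close>
    then have "M *v e = 0"
      using pos_semidef_kernel insert.prems(1) by (simp add: d_def m_def)
    then show ?thesis
      using insert.IH[OF insert.prems(1)] insert.prems(2) by (metis e_def insertE)
  next
    case False
    then have d: "d > 0" using psd[of e] by (simp add: d_def m_def)
    \<comment> \<open>Elimination with pivot \<open>d\<close>: the subtracted matrix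
      \<open>m m^T / d\<close> agrees with \<open>M\<close> on \<open>e\<close>.\<close>
    define M' where "M' = M - (1 / d) *\<^sub>R outer_square m"
    have M'v: "M' *v x = M *v x - ((m \<bullet> x) / d) *\<^sub>R m" for x
      by (simp add: M'_def matrix_vector_mult_diff_rdistrib scaleR_matrix_vector_assoc[symmetric]
          outer_square_mult_vec)
    have me: "m \<bullet> x = e \<bullet> (M *v x)" for x
      using inner_symmetric_matrix[OF sym, of x e] by (simp add: m_def inner_commute)
    have "pos_semidef M'"
      unfolding pos_semidef_def
    proof (intro conjI allI)
      show "symmetric_matrix M'"
        using sym by (simp add: symmetric_matrix_def M'_def transpose_def outer_square_def
            vec_eq_iff mult.commute)
      fix x
      \<comment> \<open>Divided by \<open>d\<close>, this is exactly nonnegativity of the form of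
        \<open>M'\<close>.\<close>
      have "(m \<bullet> x)\<^sup>2 \<le> d * (x \<bullet> (M *v x))"
        using pos_semidef_Cauchy_Schwarz[OF insert.prems(1), of e x]
        by (simp add: me[unfolded m_def] d_def m_def)
      then show "0 \<le> x \<bullet> (M' *v x)"
        using d by (simp add: M'v inner_simps inner_commute[of x m] power2_eq_square field_simps)
    qed
    moreover have "M' *v axis j 1 = 0" if "j \<notin> F" for j
    proof (cases "j = i")
      case True
      have "M' *v e = 0"
        using d inner_commute[of m e] by (simp add: M'v flip: d_def m_def)
      with True show ?thesis by (simp add: e_def)
    next
      case False
      \<comment> \<open>A basis vector already in the kernel of \<open>M\<close> is orthogonal to
        \<open>m\<close>, hence stays in the kernel.\<close>
      with that insert.prems(2)[of j] show ?thesis by (simp add: M'v me)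
    qed
    ultimately have IH: "0 \<le> trace (C ** M')" "trace (C ** M') = 0 \<Longrightarrow> C ** M' = 0"
      using insert.IH by blast+
    have CM: "C ** M = C ** M' + (1 / d) *\<^sub>R (C ** outer_square m)"
      by (simp add: M'_def matrix_diff_ldistrib matrix_scalar_ac flip: scalar_matrix_assoc)
    then have tr: "trace (C ** M) = trace (C ** M') + (m \<bullet> (C *v m)) / d"
      by (simp add: trace_add trace_scaleR trace_mult_outer_square)
    have Cm: "0 \<le> m \<bullet> (C *v m)" using assms(2) by (simp add: pos_semidef_def)
    show ?thesis
    proof (intro conjI impI)
      show "0 \<le> trace (C ** M)" using tr IH(1) Cm d by simp
      assume "trace (C ** M) = 0"
      \<comment> \<open>Both summands in \<open>tr\<close> are nonnegative, so both vanish.\<close>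
      then have "trace (C ** M') = 0 \<and> (m \<bullet> (C *v m)) / d = 0"
        using tr IH(1) Cm d by (metis add_nonneg_eq_0_iff divide_nonneg_pos)
      then have "C ** M' = 0" "C *v m = 0"
        using IH(2) pos_semidef_kernel[OF assms(2)] d by auto
      then show "C ** M = 0"
        by (simp add: CM matrix_mult_outer_square vec_eq_iff)
    qed
  qed
qed

text \<open>For \<open>F = UNIV\<close> the condition on basis vectors is vacuous. With
  \<open>C = X^T M X\<close> these facts yield nonnegativity and definiteness of the squared
  norm.\<close>

lemma trace_pos_semidef_mult:
  fixes C M :: "real^'n^'n"
  assumes "pos_semidef C" and "pos_semidef M"
  shows trace_pos_semidef_mult_nonneg: "0 \<le> trace (C ** M)"
    and trace_pos_semidef_mult_eq_0: "trace (C ** M) = 0 \<Longrightarrow> C ** M = 0"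
  using trace_pos_semidef_mult_aux[of UNIV C M] assms by auto

section \<open>Inverses and congruences of positive definite matrices\<close>

lemma sym_pos_def_imp_pos_semidef: "sym_pos_def M \<Longrightarrow> pos_semidef M"
  by (metis inner_zero_left less_eq_real_def pos_semidef_def sym_pos_def_def)

lemma sym_pos_def_invertible:
  assumes "sym_pos_def W"
  shows "invertible W"
proof -
  have "x = 0" if "W *v x = 0" for x
    using assms that unfolding sym_pos_def_def by (metis inner_zero_right less_irrefl)
  then show ?thesis
    by (simp add: invertible_left_inverse matrix_left_invertible_ker)
qed

lemma matrix_inv_left_mult: "invertible A \<Longrightarrow> matrix_inv A ** A = mat 1"
  and matrix_inv_right_mult: "invertible A \<Longrightarrow> A ** matrix_inv A = mat 1"
  for A :: "real^'n^'n"
  by (auto simp: matrix_inv_def invertible_def intro: someI2_ex)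

lemma symmetric_matrix_inv:
  fixes A :: "real^'n^'n"
  assumes "invertible A" and "symmetric_matrix A"
  shows "symmetric_matrix (matrix_inv A)"
proof -
  have "transpose (matrix_inv A) ** A = mat 1"
    using assms matrix_inv_right_mult[of A]
    by (metis matrix_transpose_mul symmetric_matrix_def transpose_mat)
  then have "transpose (matrix_inv A) ** (A ** matrix_inv A) = matrix_inv A"
    by (simp add: matrix_mul_assoc)
  then show ?thesis
    using assms by (simp add: matrix_inv_right_mult symmetric_matrix_def)
qed

text \<open>Substituting \<open>x = W u\<close> turns the form of the inverse at \<open>x\<close>
  into the form of \<open>W\<close> at \<open>u\<close>.\<close>

lemma sym_pos_def_matrix_inv:
  assumes "sym_pos_def W"
  shows "sym_pos_def (matrix_inv W)"
  unfolding sym_pos_def_def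
proof (intro conjI allI impI)
  note inv = sym_pos_def_invertible[OF assms]
  show "symmetric_matrix (matrix_inv W)"
    using assms inv symmetric_matrix_inv by (auto simp: sym_pos_def_def)
  fix x :: "real^'a"
  assume x: "x \<noteq> 0"
  define u where "u = matrix_inv W *v x"
  have xu: "x = W *v u"
    by (simp add: u_def matrix_vector_mul_assoc matrix_inv_right_mult[OF inv])
  then have "u \<noteq> 0" using x by auto
  then have "0 < u \<bullet> x"
    using assms by (simp add: xu sym_pos_def_def)
  then show "0 < x \<bullet> (matrix_inv W *v x)"
    by (simp add: u_def inner_commute)
qed

lemma inner_congruence:
  fixes M :: "real^'n^'n" and X :: "real^'p^'n"
  shows "x \<bullet> ((transpose X ** M ** X) *v x) = (X *v x) \<bullet> (M *v (X *v x))"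
  using dot_lmul_matrix[of x "transpose X" "M *v (X *v x)"]
  by (simp add: matrix_vector_mul_assoc matrix_mul_assoc)

lemma pos_semidef_congruence:
  fixes M :: "real^'n^'n" and X :: "real^'p^'n"
  assumes "pos_semidef M"
  shows "pos_semidef (transpose X ** M ** X)"
  using assms
  by (simp add: pos_semidef_def symmetric_matrix_def inner_congruence matrix_transpose_mul
      matrix_mul_assoc)

section \<open>The weighted Frobenius norm\<close>

text \<open>The radicand is the trace of a product of the semidefinite matrices
  \<open>X^T M X\<close> and \<open>M\<close>, so squaring undoes \<open>sqrt\<close>.\<close>

lemma weighted_frobenius_norm_power2:
  assumes "sym_pos_def M"
  shows "(weighted_frobenius_norm M X)\<^sup>2 = trace (transpose X ** M ** X ** M)"
  using trace_pos_semidef_mult_nonneg[of "transpose X ** M ** X" M] assms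
  by (simp add: weighted_frobenius_norm_def pos_semidef_congruence sym_pos_def_imp_pos_semidef)

text \<open>Vanishing of the trace forces \<open>X^T M X M = 0\<close>. Cancelling the invertible
  \<open>M\<close> gives \<open>X^T M X = 0\<close>, and definiteness of \<open>M\<close> then kills
  every \<open>X x\<close>.\<close>

lemma weighted_frobenius_norm_eq_0:
  fixes M X :: "real^'n^'n"
  assumes "sym_pos_def M" and "weighted_frobenius_norm M X = 0"
  shows "X = 0"
proof -
  let ?C = "transpose X ** M ** X"
  note psd = sym_pos_def_imp_pos_semidef[OF assms(1)]
  have "trace (?C ** M) = 0"
    using assms(2) by (simp add: weighted_frobenius_norm_def)
  then have "?C ** M = 0"
    by (rule trace_pos_semidef_mult_eq_0[OF pos_semidef_congruence[OF psd] psd])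
  then have "?C ** (M ** matrix_inv M) = 0"
    by (subst matrix_mul_assoc) simp
  then have C: "?C = 0"
    by (simp add: matrix_inv_right_mult sym_pos_def_invertible[OF assms(1)])
  have "X *v x = 0" for x
  proof (rule ccontr)
    assume "X *v x \<noteq> 0"
    then have "0 < (X *v x) \<bullet> (M *v (X *v x))"
      using assms(1) by (simp add: sym_pos_def_def)
    also have "\<dots> = x \<bullet> (?C *v x)"
      by (rule inner_congruence[symmetric])
    finally show False by (simp add: C)
  qed
  then show ?thesis by (metis matrix_eq matrix_vector_mult_0)
qed

text \<open>Transposition and cyclic rotation under the trace carry one cross term into the other,
  so both vanish.\<close>

lemma weighted_frobenius_norm_Pythagoras:
  fixes M D T :: "real^'n^'n"
  assumes "sym_pos_def M" and "trace (transpose D ** M ** T ** M) = 0"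
  shows "(weighted_frobenius_norm M (D + T))\<^sup>2
    = (weighted_frobenius_norm M D)\<^sup>2 + (weighted_frobenius_norm M T)\<^sup>2"
proof -
  have M: "transpose M = M"
    using assms(1) by (simp add: sym_pos_def_def symmetric_matrix_def)
  have "trace (transpose T ** M ** D ** M) = trace (transpose (transpose T ** M ** D ** M))"
    by (rule trace_transpose[symmetric])
  also have "\<dots> = trace (M ** (transpose D ** M ** T))"
    by (simp add: matrix_transpose_mul M matrix_mul_assoc)
  also have "\<dots> = 0"
    using assms(2) by (subst trace_mul_sym)
  finally show ?thesis
    using assms(2)
    by (simp add: weighted_frobenius_norm_power2[OF assms(1)] matrix_add_ldistrib
        matrix_add_rdistrib trace_add transpose_add)
qed

section \<open>The normal equation\<close>

text \<open>Split \<open>B^T b = u + w\<close> with \<open>u\<close> in the range of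
  \<open>N = B^T W B\<close> and \<open>w\<close> orthogonal to it. Then \<open>w\<close> is
  orthogonal to \<open>N w\<close>, so \<open>B w = 0\<close> by definiteness of \<open>W\<close>.
  Hence \<open>w\<close> is orthogonal to \<open>B^T b\<close> as well as to \<open>u\<close>, which
  forces \<open>w = 0\<close>.\<close>

lemma range_normal_matrix:
  fixes B :: "real^'q^'n" and W :: "real^'n^'n"
  assumes "sym_pos_def W"
  shows "\<exists>h. (transpose B ** W ** B) *v h = transpose B *v b"
proof -
  let ?N = "transpose B ** W ** B"
  have psd: "pos_semidef ?N"
    by (rule pos_semidef_congruence[OF sym_pos_def_imp_pos_semidef[OF assms]])
  have "subspace (range ((*v) ?N))"
    using linear_subspace_image[OF matrix_vector_mul_linear subspace_UNIV] .
  then obtain u w where u: "u \<in> span (range ((*v) ?N))"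
    and w: "\<And>z. z \<in> span (range ((*v) ?N)) \<Longrightarrow> orthogonal w z"
    and uw: "transpose B *v b = u + w"
    using orthogonal_subspace_decomp_exists by blast
  have "w \<bullet> (?N *v w) = 0"
    using w[of "?N *v w"] by (simp add: span_base orthogonal_def)
  moreover have "w \<bullet> (?N *v w) = (B *v w) \<bullet> (W *v (B *v w))"
    by (rule inner_congruence)
  ultimately have "B *v w = 0"
    using assms unfolding sym_pos_def_def by (metis less_irrefl)
  then have "w \<bullet> (transpose B *v b) = 0"
    using dot_lmul_matrix[of w "transpose B" b] by (simp flip: transpose_matrix_vector)
  moreover have "w \<bullet> u = 0" using w[OF u] by (simp add: orthogonal_def)
  ultimately have "w = 0" using uw by (simp add: inner_simps)
  moreover have "u \<in> range ((*v) ?N)"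
    using u \<open>subspace (range ((*v) ?N))\<close> span_eq_iff by blast
  ultimately show ?thesis using uw by force
qed

text \<open>The columns of \<open>H\<close> are solutions for the basis vectors
  \<open>b = axis j 1\<close>. This covers a singular \<open>B^T W B\<close>.\<close>

lemma normal_equation_solvable:
  fixes B :: "real^'q^'n" and W :: "real^'n^'n"
  assumes "sym_pos_def W"
  obtains H where "transpose B ** W ** B ** H = transpose B"
proof -
  obtain h where h: "\<And>b. (transpose B ** W ** B) *v h b = transpose B *v b"
    using range_normal_matrix[OF assms, of B] by metis
  define H where "H = (\<chi> i j. h (axis j 1) $ i)"
  have "transpose B ** W ** B ** H = transpose B"
    unfolding vec_eq_iff
  proof (intro allI)
    fix i j
    have "(transpose B ** W ** B ** H) $ i $ j = ((transpose B ** W ** B) *v h (axis j 1)) $ i"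
      unfolding matrix_matrix_mult_def[of _ H] by (simp add: matrix_vector_mult_def H_def)
    then show "(transpose B ** W ** B ** H) $ i $ j = transpose B $ i $ j"
      by (simp add: h matrix_vector_mult_basis column_def)
  qed
  then show thesis by (rule that)
qed

section \<open>Minimizers by orthogonality\<close>

text \<open>\<open>g\<close> is the excess over the minimum, and \<open>h\<close> extracts the
  component claimed to be unique: \<open>id\<close> in the first problem, \<open>fst\<close> in the
  second, where \<open>Y\<close> need not be unique.\<close>

lemma is_arg_min_Pythagoras:
  fixes f g :: "'a \<Rightarrow> real"
  assumes "P m" and "\<And>x. P x \<Longrightarrow> f x = f m + g x" and "\<And>x. 0 \<le> g x"
    and "\<And>x. g x = 0 \<Longrightarrow> h x = h m"
  shows "h ` {x. is_arg_min f P x} = {h m}"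
proof -
  have "f m \<le> f x" if "P x" for x
    using assms(2)[OF that] assms(3)[of x] by simp
  then have "is_arg_min f P m"
    using assms(1) by (auto simp: is_arg_min_def not_less)
  moreover have "h x = h m" if "is_arg_min f P x" for x
  proof -
    have "P x" "f x \<le> f m"
      using that assms(1) by (auto simp: is_arg_min_def not_less)
    then show ?thesis
      using assms(2)[of x] assms(3)[of x] by (intro assms(4)) simp
  qed
  ultimately show ?thesis by blast
qed

text \<open>In each of the two terms a factor \<open>W\<close> cancels against its inverse. Cyclic
  rotation exposes \<open>B^T D\<close> in the first; the second contains \<open>D B\<close>, the
  transpose of \<open>B^T D\<close>.\<close>

lemma trace_constraint_orthogonal:
  fixes D W :: "real^'n^'n" and B Y :: "real^'q^'n"
  assumes "sym_pos_def W" and "symmetric_matrix D" and "transpose B ** D = 0"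
  shows "trace (transpose D ** matrix_inv W
    ** ((1/2) *\<^sub>R (Y ** transpose B ** W + W ** B ** transpose Y)) ** matrix_inv W) = 0"
proof -
  let ?M = "matrix_inv W"
  note inv = sym_pos_def_invertible[OF assms(1)]
  have D: "transpose D = D" using assms(2) by (simp add: symmetric_matrix_def)
  have "transpose (transpose B ** D) = D ** B"
    by (simp add: matrix_transpose_mul D)
  then have DB: "D ** B = 0"
    using assms(3) by (simp add: transpose_def vec_eq_iff)
  have "D ** ?M ** (Y ** transpose B ** W) ** ?M = D ** ?M ** Y ** transpose B ** (W ** ?M)"
    by (simp add: matrix_mul_assoc)
  also have "trace \<dots> = trace (transpose B ** D ** ?M ** Y)"
    using trace_mul_sym[of "D ** ?M ** Y" "transpose B"]
    by (simp add: matrix_inv_right_mult[OF inv] matrix_mul_assoc)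
  also have "\<dots> = 0" by (simp add: assms(3) trace_def)
  finally have 1: "trace (D ** ?M ** (Y ** transpose B ** W) ** ?M) = 0" .
  have "D ** ?M ** (W ** B ** transpose Y) ** ?M = D ** (?M ** W) ** B ** transpose Y ** ?M"
    by (simp add: matrix_mul_assoc)
  also have "\<dots> = 0" by (simp add: matrix_inv_left_mult[OF inv] DB)
  finally show ?thesis using 1
    by (simp add: D matrix_scalar_ac scalar_matrix_assoc[symmetric] trace_scaleR trace_add
        matrix_add_ldistrib matrix_add_rdistrib trace_def[of 0])
qed

text \<open>By the normal equation \<open>(B H)^T = H^T B^T = H^T (B^T W B) H\<close>, which is
  visibly symmetric; this holds for every solution \<open>H\<close>.\<close>

lemma symmetric_projection_exists:
  fixes B :: "real^'q^'n" and W :: "real^'n^'n"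
  assumes "sym_pos_def W"
  obtains H where "transpose B ** W ** B ** H = transpose B"
    and "symmetric_matrix (B ** H)"
proof -
  obtain H where H: "transpose B ** W ** B ** H = transpose B"
    using normal_equation_solvable[OF assms] .
  have W: "transpose W = W" using assms by (simp add: sym_pos_def_def symmetric_matrix_def)
  have "transpose (B ** H) = transpose H ** (transpose B ** W ** B ** H)"
    by (simp add: H matrix_transpose_mul)
  also have "\<dots> = transpose (transpose H ** (transpose B ** W ** B ** H))"
    by (simp add: matrix_transpose_mul W matrix_mul_assoc)
  also have "\<dots> = B ** H" by (simp add: H matrix_transpose_mul)
  finally show thesis using that H by (simp add: symmetric_matrix_def)
qed

lemma common_solution_unique:
  fixes A Xk W X0 :: "real^'n^'n" and S Y0 :: "real^'q^'n"
  defines "K \<equiv> \<lambda>Y. (1/2) *\<^sub>R (Y ** transpose (A ** S) ** W + W ** (A ** S) ** transpose Y)"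
  assumes A: "invertible A" "symmetric_matrix A" and W: "sym_pos_def W"
    and X0: "symmetric_matrix X0" "transpose S ** A ** X0 = transpose S" "X0 = Xk + K Y0"
  shows "{X. is_arg_min (\<lambda>X. 1/2 * (weighted_frobenius_norm (matrix_inv W) (X - Xk))\<^sup>2)
      (\<lambda>X. transpose S ** A ** X = transpose S \<and> X = transpose X) X} = {X0}" (is ?projection)
    and "{X. \<exists>Y. is_arg_min
      (\<lambda>(X, Y). 1/2 * (weighted_frobenius_norm (matrix_inv W) (X - matrix_inv A))\<^sup>2)
      (\<lambda>(X, Y). X = Xk + K Y) (X, Y)} = {X0}" (is ?dual)
proof -
  define n where "n = weighted_frobenius_norm (matrix_inv W)"
  note M = sym_pos_def_matrix_inv[OF W]
  have n0: "n X = 0 \<longleftrightarrow> X = 0" for X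
    using weighted_frobenius_norm_eq_0[OF M]
    by (auto simp: n_def weighted_frobenius_norm_def trace_def)
  have B: "transpose (A ** S) = transpose S ** A"
    using A(2) by (simp add: matrix_transpose_mul symmetric_matrix_def)
  have pyth: "(n (D + K Y))\<^sup>2 = (n D)\<^sup>2 + (n (K Y))\<^sup>2"
    if "symmetric_matrix D" "transpose S ** A ** D = 0" for D Y
    unfolding K_def n_def using that
    by (intro weighted_frobenius_norm_Pythagoras[OF M] trace_constraint_orthogonal[OF W])
      (simp_all add: B)
  have "id ` {X. is_arg_min (\<lambda>X. 1/2 * (n (X - Xk))\<^sup>2)
      (\<lambda>X. transpose S ** A ** X = transpose S \<and> X = transpose X) X} = {id X0}"
  proof (rule is_arg_min_Pythagoras[where g = "\<lambda>X. 1/2 * (n (X - X0))\<^sup>2"])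
    show "transpose S ** A ** X0 = transpose S \<and> X0 = transpose X0"
      using X0(1,2) by (simp add: symmetric_matrix_def)
    fix X assume "transpose S ** A ** X = transpose S \<and> X = transpose X"
    then have "transpose S ** A ** X = transpose S" "transpose X = X" by simp_all
    then have "(n ((X - X0) + K Y0))\<^sup>2 = (n (X - X0))\<^sup>2 + (n (K Y0))\<^sup>2"
      using X0(1,2) by (intro pyth)
        (simp_all add: symmetric_matrix_def transpose_diff matrix_diff_ldistrib)
    then show "1/2 * (n (X - Xk))\<^sup>2 = 1/2 * (n (X0 - Xk))\<^sup>2 + 1/2 * (n (X - X0))\<^sup>2"
      by (simp add: X0(3))
  qed (simp_all add: n0)
  then show ?projection by (simp add: n_def)
  have dual: "fst ` {z. is_arg_min (\<lambda>(X, Y). 1/2 * (n (X - matrix_inv A))\<^sup>2)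
      (\<lambda>(X, Y). X = Xk + K Y) z} = {fst (X0, Y0)}"
  proof (rule is_arg_min_Pythagoras[where g = "\<lambda>z. 1/2 * (n (fst z - X0))\<^sup>2"])
    show "(\<lambda>(X, Y). X = Xk + K Y) (X0, Y0)" using X0(3) by simp
    fix z assume "(\<lambda>(X, Y). X = Xk + K Y) z"
    then obtain X Y where z: "z = (X, Y)" "X = Xk + K Y" by auto
    \<comment> \<open>\<open>K\<close> is linear, so feasible points of the second problem differ by
      a value of \<open>K\<close>.\<close>
    have XX0: "X - X0 = K (Y - Y0)"
      by (simp add: z X0(3) K_def matrix_diff_ldistrib matrix_diff_rdistrib transpose_diff
          algebra_simps)
    have XA: "X - matrix_inv A = (X0 - matrix_inv A) + K (Y - Y0)"
      by (simp flip: XX0)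
    \<comment> \<open>The inverse of \<open>A\<close> satisfies the constraints of the first
      problem, so \<open>X0 - matrix_inv A\<close> is an admissible \<open>D\<close> in
      \<open>pyth\<close>.\<close>
    have "(n (X - matrix_inv A))\<^sup>2 = (n (X0 - matrix_inv A))\<^sup>2 + (n (X - X0))\<^sup>2"
      unfolding XA XX0 using X0(1,2) symmetric_matrix_inv[OF A]
      by (intro pyth) (simp_all add: symmetric_matrix_def transpose_diff matrix_diff_ldistrib
          matrix_mul_assoc[symmetric] matrix_inv_right_mult[OF A(1)])
    then show "(\<lambda>(X, Y). 1/2 * (n (X - matrix_inv A))\<^sup>2) z
      = (\<lambda>(X, Y). 1/2 * (n (X - matrix_inv A))\<^sup>2) (X0, Y0) + 1/2 * (n (fst z - X0))\<^sup>2"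
      by (simp add: z(1))
  qed (simp_all add: n0)
  have img: "{X. \<exists>Y. Q (X, Y)} = fst ` {z. Q z}" for Q :: "'b \<times> 'c \<Rightarrow> bool"
    by force
  show ?dual using trans[OF img dual] by (simp only: n_def fst_conv)
qed

section \<open>Full column rank and the explicit formula\<close>

lemma normal_matrix_invertible:
  fixes B :: "real^'q^'n"
  assumes "sym_pos_def W" and "inj ((*v) B)"
  shows "invertible (transpose B ** W ** B)"
proof -
  have "x = 0" if "(transpose B ** W ** B) *v x = 0" for x
  proof -
    have "(B *v x) \<bullet> (W *v (B *v x)) = 0"
      using that inner_congruence[of x B W] by simp
    then have "B *v x = B *v 0"
      using assms(1) unfolding sym_pos_def_def by fastforce
    then show "x = 0" using assms(2) by (rule injD[rotated])
  qed
  then show ?thesis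
    by (simp add: invertible_left_inverse matrix_left_invertible_ker)
qed

text \<open>Equality with one common singleton encodes existence, uniqueness and agreement of the
  solutions at once. Invertibility is asserted along with the formula because
  \<open>matrix_inv\<close> is a choice operator, meaningful only on invertible matrices.\<close>

theorem theorem5p1:
  fixes A Xk W :: "real^'n^'n" and S :: "real^'q^'n"
  assumes "invertible A" and "symmetric_matrix A"
    and "symmetric_matrix Xk"
    and "sym_pos_def W"
  shows "\<exists>Xk1 :: real^'n^'n.
    {X. is_arg_min
          (\<lambda>X. 1/2 * (weighted_frobenius_norm (matrix_inv W) (X - Xk))\<^sup>2)
          (\<lambda>X. transpose S ** A ** X = transpose S \<and> X = transpose X)
          X} = {Xk1} \<and>
    {X. \<exists>Y :: real^'q^'n. is_arg_min
          (\<lambda>(X, Y). 1/2 * (weighted_frobenius_norm (matrix_inv W) (X - matrix_inv A))\<^sup>2)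
          (\<lambda>(X, Y). X = Xk + (1/2) *\<^sub>R (Y ** transpose S ** A ** W
                                    + W ** transpose A ** S ** transpose Y))
          (X, Y)} = {Xk1} \<and>
    (rank S = CARD('q) \<longrightarrow>
      invertible (transpose S ** A ** W ** A ** S) \<and>
      (let \<Lambda> = matrix_inv (transpose S ** A ** W ** A ** S) in
        Xk1 = Xk - (Xk ** A - mat 1) ** S ** \<Lambda> ** transpose S ** A ** W
              + W ** A ** S ** \<Lambda> ** transpose S ** (A ** Xk - mat 1)
                ** (A ** S ** \<Lambda> ** transpose S ** A ** W - mat 1)))"
proof -
  define B where "B = A ** S"
  define E where "E = Xk - matrix_inv A"
  obtain H where H: "transpose B ** W ** B ** H = transpose B"
    and symP: "symmetric_matrix (B ** H)"
    using symmetric_projection_exists[OF assms(4)] .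
  define P where "P = B ** H"
  define X0 where "X0 = matrix_inv A + (mat 1 - W ** P) ** E ** (mat 1 - P ** W)"
  have tA: "transpose A = A" and tW: "transpose W = W" and tP: "transpose P = P"
    and tE: "transpose E = E" and tI: "transpose (matrix_inv A) = matrix_inv A"
    using assms symP symmetric_matrix_inv[OF assms(1,2)]
    by (simp_all add: symmetric_matrix_def sym_pos_def_def P_def E_def transpose_diff)
  have BS: "transpose B = transpose S ** A"
    by (simp add: B_def matrix_transpose_mul tA)
  \<comment> \<open>The leading part \<open>matrix_inv A + E\<close> of the expanded product is
    \<open>Xk\<close>.\<close>
  have X0_eq: "X0 = Xk - E ** P ** W - W ** P ** E + W ** P ** E ** P ** W"
    by (simp add: X0_def E_def matrix_diff_ldistrib matrix_diff_rdistrib matrix_mul_assoc)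
  have "symmetric_matrix X0"
    by (simp add: symmetric_matrix_def X0_def transpose_add transpose_diff matrix_transpose_mul
        tW tP tE tI matrix_mul_assoc)
  moreover have "transpose S ** A ** X0 = transpose S"
  proof -
    \<comment> \<open>This is the normal equation; it removes the \<open>E\<close> term from
      \<open>transpose B ** X0\<close>.\<close>
    have "transpose B ** (mat 1 - W ** P) = 0"
      using H by (simp add: matrix_diff_ldistrib P_def matrix_mul_assoc)
    then have "transpose B ** X0 = transpose B ** matrix_inv A"
      by (simp add: X0_def matrix_add_ldistrib matrix_mul_assoc)
    then show ?thesis
      by (simp add: BS matrix_mul_assoc[symmetric] matrix_inv_right_mult[OF assms(1)])
  qed
  \<comment> \<open>Chosen so that \<open>Y0 B^T = W P E P - 2 E P\<close>, using
    \<open>H^T B^T = P\<close>. After halving, each of the two transposed terms supplies half of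
    \<open>W P E P W\<close> and one of the linear terms in \<open>X0_eq\<close>.\<close>
  moreover define Y0 where "Y0 = W ** P ** E ** transpose H - 2 *\<^sub>R (E ** transpose H)"
  have "X0 = Xk + (1/2) *\<^sub>R (Y0 ** transpose B ** W + W ** B ** transpose Y0)"
  proof -
    have HB: "transpose H ** transpose B = P"
      using tP by (simp add: P_def matrix_transpose_mul)
    have "Y0 ** transpose B = W ** P ** E ** P - 2 *\<^sub>R (E ** P)"
      by (simp add: Y0_def matrix_diff_rdistrib scalar_matrix_assoc[symmetric]
          matrix_mul_assoc[symmetric] HB)
    moreover have "B ** transpose Y0 = P ** E ** P ** W - 2 *\<^sub>R (P ** E)"
      using arg_cong[OF calculation, of transpose]
      by (simp add: matrix_transpose_mul transpose_diff transpose_scalar tW tP tE matrix_mul_assoc)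
    ultimately show ?thesis
      by (simp add: X0_eq matrix_mul_assoc[symmetric] matrix_diff_ldistrib matrix_diff_rdistrib
          matrix_scalar_ac scalar_matrix_assoc[symmetric])
        (simp add: algebra_simps flip: scaleR_2)
  qed
  ultimately have sets: "{X. is_arg_min
          (\<lambda>X. 1/2 * (weighted_frobenius_norm (matrix_inv W) (X - Xk))\<^sup>2)
          (\<lambda>X. transpose S ** A ** X = transpose S \<and> X = transpose X)
          X} = {X0}"
    "{X. \<exists>Y :: real^'q^'n. is_arg_min
          (\<lambda>(X, Y). 1/2 * (weighted_frobenius_norm (matrix_inv W) (X - matrix_inv A))\<^sup>2)
          (\<lambda>(X, Y). X = Xk + (1/2) *\<^sub>R (Y ** transpose S ** A ** W
                                    + W ** transpose A ** S ** transpose Y))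
          (X, Y)} = {X0}"
    using common_solution_unique[OF assms(1,2,4), of X0 S Xk Y0]
    by (simp_all add: B_def matrix_transpose_mul tA matrix_mul_assoc)
  define \<Lambda> where "\<Lambda> = matrix_inv (transpose S ** A ** W ** A ** S)"
  have N: "transpose S ** A ** W ** A ** S = transpose B ** W ** B"
    unfolding BS by (simp add: B_def matrix_mul_assoc)
  have full: "invertible (transpose S ** A ** W ** A ** S) \<and>
      Xk - (Xk ** A - mat 1) ** S ** \<Lambda> ** transpose S ** A ** W
              + W ** A ** S ** \<Lambda> ** transpose S ** (A ** Xk - mat 1)
                ** (A ** S ** \<Lambda> ** transpose S ** A ** W - mat 1) = X0"
    if "rank S = CARD('q)"
  proof -
    have "inj ((*v) A)"
      using assms(1) by (simp add: invertible_left_inverse matrix_left_invertible_injective)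
    moreover have "inj ((*v) S)" using that by (simp add: full_rank_injective)
    ultimately have "inj ((*v) B)"
      by (auto simp: inj_def B_def matrix_vector_mul_assoc[symmetric])
    then have inv: "invertible (transpose B ** W ** B)"
      by (rule normal_matrix_invertible[OF assms(4)])
    \<comment> \<open>Multiplying the normal equation by \<open>\<Lambda>\<close> determines
      \<open>H\<close>.\<close>
    have "H = \<Lambda> ** (transpose B ** W ** B) ** H"
      by (simp add: \<Lambda>_def N matrix_inv_left_mult[OF inv])
    also have "\<dots> = \<Lambda> ** transpose B"
      by (simp add: H matrix_mul_assoc[symmetric, of \<Lambda>])
    finally have P: "P = A ** S ** \<Lambda> ** transpose S ** A"
      by (simp add: P_def B_def matrix_mul_assoc matrix_transpose_mul tA)
    \<comment> \<open>Factoring both residuals through \<open>E\<close> turns the claimed formula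
      into \<open>Xk - E P W + W P E (P W - I)\<close>, which is \<open>X0_eq\<close>.\<close>
    have EA: "Xk ** A - mat 1 = E ** A" and AE: "A ** Xk - mat 1 = A ** E"
      by (simp_all add: E_def matrix_diff_ldistrib matrix_diff_rdistrib
          matrix_inv_left_mult[OF assms(1)] matrix_inv_right_mult[OF assms(1)])
    show ?thesis
      using inv unfolding N EA AE X0_eq P
      by (simp add: matrix_diff_ldistrib matrix_diff_rdistrib matrix_mul_assoc)
  qed
  show ?thesis
    unfolding Let_def \<Lambda>_def[symmetric]
    by (intro exI[of _ X0] conjI impI sets conjunct1[OF full] conjunct2[OF full, symmetric])
qed

end
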